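(* Let $K$ be an arbitrary field and let $\mathcal H\subseteq K^*$ be a complete system of representatives of the equivalence classes $K^*/\approx$. Then, up to isomorphism, the 2-dimensional endo-commutative straight algebras of type I over $K$ are classified by the family $\{S(p,0,0,0,0,0)\}_{p\in\mathcal H}$, where $S(p,0,0,0,0,0)$ has multiplication $e^2=f$, $ef=fe=0$, $f^2=pe$ with respect to a linear base $\{e,f\}$. That is: for every $p\in\mathcal H$ the algebra $S(p,0,0,0,0,0)$ is an endo-commutative straight algebra of type I, and every 2-dimensional endo-commutative straight algebra of type I over $K$ is isomorphic to $S(p,0,0,0,0,0)$ for exactly one $p\in\mathcal H$.
   Context: $K$ is an arbitrary field. An algebra over $K$ is a $K$-vector space with a $K$-bilinear multiplication, not assumed associative, commutative or unital; isomorphism means bijective $K$-linear multiplicative map. An algebra $A$ is endo-commutative if $x^2y^2=(xy)^2$ for all $x,y\in A$. A 2-dimensional algebra is curled if $x^2$ is a scalar multiple of $x$ for every element $x$; otherwise it is straight. For $(p,q,a,b,c,d)\in K^6$, $S(p,q,a,b,c,d)$ denotes the (straight) algebra over $K$ with linear base $\{e,f\}$ and multiplication $e^2=f$, $ef=ae+bf$, $fe=ce+df$, $f^2=pe+qf$. An endo-commutative straight algebra of type I over $K$ is an endo-commutative algebra of the form $S(p,q,a,b,c,d)$ for which exactly one of $p,a,c$ is nonzero. $K^*=K\setminus\{0\}$ and $(K^* )^3=\{k^3: k\in K^*\}$. For $a,b\in K^*$, write $a\sim b$ if $a/b\in(K^* )^3$, and write $a\approx b$ if $a\sim b$ or $a^2\sim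 b$. The relation $\approx$ is an equivalence relation on $K^*$. *)

theory Defs
  imports "HOL-Analysis.Analysis"
begin

locale nonassoc_algebra = vector_space smul
  for smul :: "'k::field \<Rightarrow> 'v::ab_group_add \<Rightarrow> 'v" +
  fixes mul :: "'v \<Rightarrow> 'v \<Rightarrow> 'v"
  assumes linear_mult_right: "\<And>x. Vector_Spaces.linear smul smul (\<lambda>y. mul x y)"
    and linear_mult_left: "\<And>y. Vector_Spaces.linear smul smul (\<lambda>x. mul x y)"

definition endo_commutative ::
  "('k::field \<Rightarrow> 'v::ab_group_add \<Rightarrow> 'v) \<Rightarrow> ('v \<Rightarrow> 'v \<Rightarrow> 'v) \<Rightarrow> bool" where
  "endo_commutative smul mul \<longleftrightarrow> nonassoc_algebra smul mul \<and>
     (\<forall>x y. mul (mul x x) (mul y y) = mul (mul x y) (mul x y))"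

definition two_dimensional ::
  "('k::field \<Rightarrow> 'v::ab_group_add \<Rightarrow> 'v) \<Rightarrow> ('v \<Rightarrow> 'v \<Rightarrow> 'v) \<Rightarrow> bool" where
  "two_dimensional smul mul \<longleftrightarrow>
     nonassoc_algebra smul mul \<and> vector_space.dim smul UNIV = 2"

definition curled ::
  "('k::field \<Rightarrow> 'v::ab_group_add \<Rightarrow> 'v) \<Rightarrow> ('v \<Rightarrow> 'v \<Rightarrow> 'v) \<Rightarrow> bool" where
  "curled smul mul \<longleftrightarrow> two_dimensional smul mul \<and> (\<forall>x. \<exists>k. mul x x = smul k x)"

definition straight ::
  "('k::field \<Rightarrow> 'v::ab_group_add \<Rightarrow> 'v) \<Rightarrow> ('v \<Rightarrow> 'v \<Rightarrow> 'v) \<Rightarrow> bool" where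
  "straight smul mul \<longleftrightarrow> two_dimensional smul mul \<and> \<not> curled smul mul"

definition algebra_isomorphic ::
  "('k::field \<Rightarrow> 'v::ab_group_add \<Rightarrow> 'v) \<Rightarrow> ('v \<Rightarrow> 'v \<Rightarrow> 'v) \<Rightarrow>
   ('k \<Rightarrow> 'w::ab_group_add \<Rightarrow> 'w) \<Rightarrow> ('w \<Rightarrow> 'w \<Rightarrow> 'w) \<Rightarrow> bool" where
  "algebra_isomorphic s1 m1 s2 m2 \<longleftrightarrow>
     (\<exists>\<phi>. Vector_Spaces.linear s1 s2 \<phi> \<and> bij \<phi> \<and> (\<forall>x y. \<phi> (m1 x y) = m2 (\<phi> x) (\<phi> y)))"

definition has_form_S ::
  "('k::field \<Rightarrow> 'v::ab_group_add \<Rightarrow> 'v) \<Rightarrow> ('v \<Rightarrow> 'v \<Rightarrow> 'v) \<Rightarrow>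
   'k \<Rightarrow> 'k \<Rightarrow> 'k \<Rightarrow> 'k \<Rightarrow> 'k \<Rightarrow> 'k \<Rightarrow> bool" where
  "has_form_S smul mul p q a b c d \<longleftrightarrow> nonassoc_algebra smul mul \<and>
     (\<exists>e f. e \<noteq> f \<and> \<not> module.dependent smul {e, f} \<and> module.span smul {e, f} = UNIV \<and>
        mul e e = f \<and>
        mul e f = smul a e + smul b f \<and>
        mul f e = smul c e + smul d f \<and>
        mul f f = smul p e + smul q f)"

text \<open>The concrete model on $K^2$ with $e = (1,0)$, $f = (0,1)$: the multiplication table,
  extended bilinearly.\<close>

definition S_mult ::
  "'k::field \<Rightarrow> 'k \<Rightarrow> 'k \<Rightarrow> 'k \<Rightarrow> 'k \<Rightarrow> 'k \<Rightarrow> 'k^2 \<Rightarrow> 'k^2 \<Rightarrow> 'k^2" where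
  "S_mult p q a b c d x y =
     (x $ 1 * y $ 1) *s vector [0, 1] +
     (x $ 1 * y $ 2) *s vector [a, b] +
     (x $ 2 * y $ 1) *s vector [c, d] +
     (x $ 2 * y $ 2) *s vector [p, q]"

lemma nonassoc_algebra_S: "nonassoc_algebra (*s) (S_mult p q a b c d)"
  by unfold_locales
    (auto simp: S_mult_def vec_eq_iff forall_2 vector_2 algebra_simps)

lemma has_form_S_S_mult: "has_form_S (*s) (S_mult p q a b c d) p q a b c d"
proof -
  define e f :: "'a^2" where "e = vector [1, 0]" and "f = vector [0, 1]"
  have comp: "e $ 1 = 1" "e $ 2 = 0" "f $ 1 = 0" "f $ 2 = 1"
    by (simp_all add: e_def f_def)
  have ne: "e \<noteq> f"
    using comp by (metis zero_neq_one)
  have "e \<notin> vec.span {f}"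
    using comp by (auto simp: vec.span_singleton)
  then have ind: "vec.independent {e, f}"
    using comp by (intro vec.independent_insertI) (auto simp: vec.independent_empty)
  have "x \<in> vec.span {e, f}" for x :: "'a^2"
  proof -
    have "x = x $ 1 *s e + x $ 2 *s f"
      by (simp add: vec_eq_iff forall_2 comp)
    then show ?thesis
      by (metis insertI1 insertI2 vec.span_add vec.span_base vec.span_scale)
  qed
  then have "vec.span {e, f} = UNIV" by blast
  moreover have "S_mult p q a b c d e e = f"
    "S_mult p q a b c d e f = a *s e + b *s f"
    "S_mult p q a b c d f e = c *s e + d *s f"
    "S_mult p q a b c d f f = p *s e + q *s f"
    by (simp_all add: S_mult_def vec_eq_iff forall_2 comp)
  ultimately show ?thesis
    unfolding has_form_S_def using nonassoc_algebra_S ne ind by blast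
qed

lemma has_form_S_imp_straight:
  assumes "has_form_S smul mul p q a b c d"
  shows "straight smul mul"
proof -
  interpret nonassoc_algebra smul mul
    using assms by (simp add: has_form_S_def)
  obtain e f where ef: "e \<noteq> f" "independent {e, f}" "span {e, f} = UNIV" "mul e e = f"
    using assms by (auto simp: has_form_S_def)
  have "dim UNIV = card {e, f}"
    using ef by (intro dim_unique) auto
  then have "two_dimensional smul mul"
    using ef nonassoc_algebra_axioms by (simp add: two_dimensional_def)
  moreover have "mul e e \<noteq> smul k e" for k
  proof
    assume "mul e e = smul k e"
    then have "f \<in> span ({e, f} - {f})"
      using ef by (auto simp: insert_Diff_if intro: span_scale span_base)
    then show False
      using ef(2) by (auto simp: dependent_def)
  qed
  ultimately show ?thesis
    by (auto simp: straight_def curled_def)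
qed

text \<open>Straightness is implied by the form, see \<open>has_form_S_imp_straight\<close>.\<close>

definition endo_commutative_type_I ::
  "('k::field \<Rightarrow> 'v::ab_group_add \<Rightarrow> 'v) \<Rightarrow> ('v \<Rightarrow> 'v \<Rightarrow> 'v) \<Rightarrow> bool" where
  "endo_commutative_type_I smul mul \<longleftrightarrow> endo_commutative smul mul \<and>
     (\<exists>p q a b c d. has_form_S smul mul p q a b c d \<and>
        (p \<noteq> 0 \<and> a = 0 \<and> c = 0 \<or>
         p = 0 \<and> a \<noteq> 0 \<and> c = 0 \<or>
         p = 0 \<and> a = 0 \<and> c \<noteq> 0))"

definition nonzero_cubes :: "'k::field set" where
  "nonzero_cubes = {k ^ 3 | k. k \<noteq> 0}"

definition cube_sim :: "'k::field \<Rightarrow> 'k \<Rightarrow> bool" where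
  "cube_sim a b \<longleftrightarrow> a / b \<in> nonzero_cubes"

definition approx_rel :: "('k::field \<times> 'k) set" where
  "approx_rel = {(a, b). a \<noteq> 0 \<and> b \<noteq> 0 \<and> (cube_sim a b \<or> cube_sim (a\<^sup>2) b)}"

lemma cube_simI: "k \<noteq> 0 \<Longrightarrow> a = k ^ 3 * b \<Longrightarrow> b \<noteq> 0 \<Longrightarrow> cube_sim a b"
  by (auto simp: cube_sim_def nonzero_cubes_def)

lemma cube_simE:
  assumes "cube_sim a b" "b \<noteq> 0"
  obtains k where "k \<noteq> 0" "a = k ^ 3 * b"
  using assms by (auto simp: cube_sim_def nonzero_cubes_def divide_eq_eq)

lemma equiv_approx_rel: "equiv (- {0}) (approx_rel :: ('k::field \<times> 'k) set)"
proof (rule equivI)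
  show "approx_rel \<subseteq> (- {0}) \<times> (- {0 :: 'k})"
    by (auto simp: approx_rel_def)
  show "refl_on (- {0}) (approx_rel :: ('k \<times> 'k) set)"
    by (auto simp: refl_on_def approx_rel_def intro: cube_simI[of 1])
  show "sym (approx_rel :: ('k \<times> 'k) set)"
  proof (rule symI)
    fix a b :: 'k
    assume "(a, b) \<in> approx_rel"
    then have nz: "a \<noteq> 0" "b \<noteq> 0" and "cube_sim a b \<or> cube_sim (a\<^sup>2) b"
      by (auto simp: approx_rel_def)
    then consider k where "k \<noteq> 0" "a = k ^ 3 * b" | k where "k \<noteq> 0" "a\<^sup>2 = k ^ 3 * b"
      by (auto elim: cube_simE)
    then show "(b, a) \<in> approx_rel"
    proof cases
      case 1
      then have "cube_sim b a"
        using nz by (intro cube_simI[of "inverse k"]) (auto simp: field_simps)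
      then show ?thesis using nz by (auto simp: approx_rel_def)
    next
      case 2
      then have "b = a\<^sup>2 / k ^ 3" by (simp add: field_simps)
      then have "b\<^sup>2 = (a / k\<^sup>2) ^ 3 * a"
        by (simp add: power_divide eval_nat_numeral field_simps)
      then have "cube_sim (b\<^sup>2) a"
        using nz 2 by (intro cube_simI[of "a / k\<^sup>2"]) auto
      then show ?thesis using nz by (auto simp: approx_rel_def)
    qed
  qed
  show "trans (approx_rel :: ('k \<times> 'k) set)"
  proof (rule transI)
    fix a b c :: 'k
    assume "(a, b) \<in> approx_rel" "(b, c) \<in> approx_rel"
    then have nz: "a \<noteq> 0" "b \<noteq> 0" "c \<noteq> 0"
      and "cube_sim a b \<or> cube_sim (a\<^sup>2) b" and "cube_sim b c \<or> cube_sim (b\<^sup>2) c"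
      by (auto simp: approx_rel_def)
    then obtain k l where kl: "k \<noteq> 0" "l \<noteq> 0"
      and ab: "a = k ^ 3 * b \<or> a\<^sup>2 = k ^ 3 * b" and bc: "b = l ^ 3 * c \<or> b\<^sup>2 = l ^ 3 * c"
      by (metis cube_simE)
    consider "a = (k * l) ^ 3 * c" | "a\<^sup>2 = (k\<^sup>2 * l) ^ 3 * c" | "a\<^sup>2 = (k * l) ^ 3 * c"
      | "a * a ^ 3 = (k\<^sup>2 * l) ^ 3 * c"
    proof -
      have "a\<^sup>2 = (k\<^sup>2 * l) ^ 3 * c" if "a = k ^ 3 * b" "b\<^sup>2 = l ^ 3 * c"
        using that by algebra
      moreover have "a * a ^ 3 = (k\<^sup>2 * l) ^ 3 * c" if "a\<^sup>2 = k ^ 3 * b" "b\<^sup>2 = l ^ 3 * c"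
        using that by algebra
      ultimately show thesis
        using ab bc that by (auto simp: power_mult_distrib mult.assoc)
    qed
    then show "(a, c) \<in> approx_rel"
    proof cases
      case 4
      then have "a = (k\<^sup>2 * l / a) ^ 3 * c"
        using nz by (simp add: power_divide field_simps)
      then have "cube_sim a c"
        using nz kl by (intro cube_simI[of "k\<^sup>2 * l / a"]) auto
      then show ?thesis using nz by (auto simp: approx_rel_def)
    qed (use nz kl in \<open>auto simp: approx_rel_def intro: cube_simI[of "k * l"] cube_simI[of "k\<^sup>2 * l"]\<close>)
  qed
qed

definition complete_representatives :: "'k::field set \<Rightarrow> bool" where
  "complete_representatives H \<longleftrightarrow>
     H \<subseteq> - {0} \<and> (\<forall>C \<in> (- {0}) // approx_rel. \<exists>!h. h \<in> H \<and> h \<in> C)"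

end

theory Submission
  imports Defs
begin

text \<open>
  Evaluating the identity \<open>x\<^sup>2 y\<^sup>2 = (x y)\<^sup>2\<close> at basis vectors and their sums forces an
  endo-commutative \<open>S(p,q,a,b,c,d)\<close> of type I to have \<open>q = a = b = c = d = 0\<close>; since \<open>K\<close> may be
  as small as \<open>GF(2)\<close>, coefficients are never compared as polynomials.
  An isomorphism from \<open>S(p,0,0,0,0,0)\<close> to \<open>S(q,0,0,0,0,0)\<close> is determined by \<open>\<phi> e = u e + v f\<close>, as
  \<open>f = e\<^sup>2\<close>. The relation \<open>e f = 0\<close> gives \<open>u v = 0\<close>, and \<open>f\<^sup>2 = p e\<close> then gives \<open>p = q u\<^sup>3\<close> or
  \<open>p = q\<^sup>2 v\<^sup>3\<close>: these are the two cases of \<open>\<approx>\<close>.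
\<close>

lemma algebra_isomorphic_sym:
  assumes "algebra_isomorphic s1 m1 s2 m2"
  shows "algebra_isomorphic s2 m2 s1 m1"
proof -
  obtain \<phi> where lin: "Vector_Spaces.linear s1 s2 \<phi>" and bij: "bij \<phi>"
    and mult: "\<And>x y. \<phi> (m1 x y) = m2 (\<phi> x) (\<phi> y)"
    using assms by (auto simp: algebra_isomorphic_def)
  \<comment> \<open>Rewriting with this equivalence turns equations about \<open>inv \<phi>\<close>
    into equations about \<open>\<phi>\<close>, whose linearity and multiplicativity are
    known.\<close>
  have inv: "inv \<phi> y = x \<longleftrightarrow> y = \<phi> x" for x y
    using bij by (metis bij_inv_eq_iff)
  have \<phi>_inv: "\<phi> (inv \<phi> y) = y" for y
    using inv by metis
  have "Vector_Spaces.linear s2 s1 (inv \<phi>)"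
    using lin unfolding Vector_Spaces.linear_iff by (auto simp: inv \<phi>_inv)
  moreover have "inv \<phi> (m2 x y) = m1 (inv \<phi> x) (inv \<phi> y)" for x y
    by (simp add: inv mult \<phi>_inv)
  ultimately show ?thesis
    unfolding algebra_isomorphic_def using bij_imp_bij_inv[OF bij] by blast
qed

lemma algebra_isomorphic_trans:
  assumes "algebra_isomorphic s1 m1 s2 m2" "algebra_isomorphic s2 m2 s3 m3"
  shows "algebra_isomorphic s1 m1 s3 m3"
proof -
  obtain \<phi> \<psi> where "Vector_Spaces.linear s1 s2 \<phi>" "bij \<phi>"
    and "\<forall>x y. \<phi> (m1 x y) = m2 (\<phi> x) (\<phi> y)"
    and "Vector_Spaces.linear s2 s3 \<psi>" "bij \<psi>"
    and "\<forall>x y. \<psi> (m2 x y) = m3 (\<psi> x) (\<psi> y)"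
    using assms by (auto simp: algebra_isomorphic_def)
  then show ?thesis
    unfolding algebra_isomorphic_def
    by (intro exI[of _ "\<psi> \<circ> \<phi>"]) (auto intro: Vector_Spaces.linear_compose bij_comp)
qed

text \<open>An identity passes to the image of a multiplicative map, and surjectivity makes that
  image the whole target.\<close>

lemma endo_commutative_isomorphic:
  assumes "algebra_isomorphic s1 m1 s2 m2" "endo_commutative s1 m1" "nonassoc_algebra s2 m2"
  shows "endo_commutative s2 m2"
proof -
  obtain \<phi> where bij: "bij \<phi>" and mult: "\<And>x y. \<phi> (m1 x y) = m2 (\<phi> x) (\<phi> y)"
    using assms(1) by (auto simp: algebra_isomorphic_def)
  have "m2 (m2 x y) (m2 x y) = m2 (m2 x x) (m2 y y)" for x y
  proof -
    obtain x' y' where "x = \<phi> x'" "y = \<phi> y'"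
      using bij by (metis bij_pointE)
    then show ?thesis
      using assms(2) by (metis endo_commutative_def mult)
  qed
  then show ?thesis
    using assms(3) by (simp add: endo_commutative_def)
qed

lemma S_mult_nth [simp]:
  "S_mult p q a b c d x y $ 1 = x $ 1 * y $ 2 * a + x $ 2 * y $ 1 * c + x $ 2 * y $ 2 * p"
  "S_mult p q a b c d x y $ 2 =
     x $ 1 * y $ 1 + x $ 1 * y $ 2 * b + x $ 2 * y $ 1 * d + x $ 2 * y $ 2 * q"
  by (simp_all add: S_mult_def)

text \<open>Moves all later computation into coordinates. The map is built from \<open>K^2\<close>
  to the abstract algebra, where it has an explicit formula, and the isomorphism is then
  reversed.\<close>

lemma has_form_S_imp_isomorphic:
  fixes smul :: "'k::field \<Rightarrow> 'v::ab_group_add \<Rightarrow> 'v"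
  assumes "has_form_S smul mul p q a b c d"
  shows "algebra_isomorphic smul mul ((*s) :: 'k \<Rightarrow> 'k^2 \<Rightarrow> 'k^2) (S_mult p q a b c d)"
proof -
  interpret nonassoc_algebra smul mul
    using assms by (simp add: has_form_S_def)
  obtain e f where ne: "e \<noteq> f" and ind: "independent {e, f}" and span: "span {e, f} = UNIV"
    and table: "mul e e = f" "mul e f = smul a e + smul b f"
      "mul f e = smul c e + smul d f" "mul f f = smul p e + smul q f"
    using assms by (auto simp: has_form_S_def)
  define \<psi> :: "'k^2 \<Rightarrow> 'v" where "\<psi> x = smul (x $ 1) e + smul (x $ 2) f" for x
  have lin: "Vector_Spaces.linear (*s) smul \<psi>"
    by unfold_locales (simp_all add: \<psi>_def scale_left_distrib scale_right_distrib)
  have "inj \<psi>"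
  proof (rule injI)
    fix x y :: "'k^2"
    assume "\<psi> x = \<psi> y"
    then have rel: "smul (x $ 1 - y $ 1) e + smul (x $ 2 - y $ 2) f = 0"
      by (simp add: \<psi>_def scale_left_diff_distrib algebra_simps)
    \<comment> \<open>Linear independence speaks of one coefficient function on
      \<open>{e, f}\<close>; \<open>e \<noteq> f\<close> keeps its two values apart.\<close>
    define g where "g w = (if w = e then x $ 1 - y $ 1 else x $ 2 - y $ 2)" for w
    have "(\<Sum>w\<in>{e, f}. smul (g w) w) = 0"
      using rel ne by (simp add: g_def)
    then have "g w = 0" if "w \<in> {e, f}" for w
      using that independentD[OF ind, of "{e, f}" g] by blast
    from this[of e] this[of f] show "x = y"
      using ne by (simp add: g_def vec_eq_iff forall_2)
  qed
  moreover have "surj \<psi>"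
    unfolding surj_def
  proof
    fix w
    have "w \<in> span {e, f}"
      using span by simp
    then obtain k l where "w = smul k e + smul l f"
      by (auto simp: span_insert span_singleton algebra_simps)
    then have "w = \<psi> (vector [k, l])"
      by (simp add: \<psi>_def)
    then show "\<exists>x. w = \<psi> x" by metis
  qed
  moreover have "\<psi> (S_mult p q a b c d x y) = mul (\<psi> x) (\<psi> y)" for x y
  proof -
    note mul_linear = linear_mult_left[unfolded Vector_Spaces.linear_iff]
      linear_mult_right[unfolded Vector_Spaces.linear_iff]
    show ?thesis
      by (simp add: \<psi>_def mul_linear table scale_left_distrib scale_right_distrib ac_simps)
  qed
  ultimately have "algebra_isomorphic (*s) (S_mult p q a b c d) smul mul"
    unfolding algebra_isomorphic_def using lin by (auto simp: bij_def)
  then show ?thesis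
    by (rule algebra_isomorphic_sym)
qed

text \<open>The product of x and y is (p x2 y2, x1 y1), a monomial in each coordinate, so both sides
  equal (p x1^2 y1^2, p^2 x2^2 y2^2).\<close>

lemma endo_commutative_S_p_zero:
  "endo_commutative ((*s) :: 'k \<Rightarrow> 'k^2 \<Rightarrow> 'k^2) (S_mult (p::'k::field) 0 0 0 0 0)"
  using nonassoc_algebra_S
  by (auto simp: endo_commutative_def vec_eq_iff forall_2)

text \<open>The alternatives \<open>a \<noteq> 0\<close> and \<open>c \<noteq> 0\<close> turn out
  contradictory, which is why \<open>p \<noteq> 0\<close> can be concluded.\<close>

lemma endo_commutative_S_type_I:
  fixes p q a b c d :: "'k::field"
  assumes "endo_commutative ((*s) :: 'k \<Rightarrow> 'k^2 \<Rightarrow> 'k^2) (S_mult p q a b c d)"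
    and "p \<noteq> 0 \<and> a = 0 \<and> c = 0 \<or> p = 0 \<and> a \<noteq> 0 \<and> c = 0 \<or> p = 0 \<and> a = 0 \<and> c \<noteq> 0"
  shows "p \<noteq> 0 \<and> q = 0 \<and> a = 0 \<and> b = 0 \<and> c = 0 \<and> d = 0"
proof -
  let ?m = "S_mult p q a b c d"
  define e f g :: "'k^2" where "e = vector [1, 0]" and "f = vector [0, 1]" and "g = vector [1, 1]"
  have ec: "?m (?m x x) (?m y y) $ i = ?m (?m x y) (?m x y) $ i" for x y i
    using assms(1) by (metis endo_commutative_def)
  note ef = ec[of e f] ec[of f e]
  note ef1 = ef[of 1] and ef2 = ef[of 2] and eg = ec[of e g 1] ec[of g e 1]
  from assms(2) consider "p \<noteq> 0" "a = 0" "c = 0" | "p = 0" "a \<noteq> 0" "c = 0" | "p = 0" "a = 0" "c \<noteq> 0"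
    by blast
  then show ?thesis
  proof cases
    case 1
    \<comment> \<open>The first coordinates read p q = p b^2 and p q = p d^2. Given this, the second
      coordinates leave p d = 0 and p b = 0.\<close>
    then have "q = b * b" "q = d * d"
      using ef1 by (simp_all add: e_def f_def)
    with 1 show ?thesis
      using ef2 by (auto simp: e_def f_def)
  next
    case 2
    \<comment> \<open>The pair (e, f) gives a^2 b = 0 and (e, e + f) gives a^2 (1 + b) = 0, hence a
      = 0, a contradiction.\<close>
    then show ?thesis
      using ef1 ef2 eg by (auto simp: e_def f_def g_def)
  next
    case 3
    \<comment> \<open>Mirror image: (f, e) gives c^2 d = 0 and (e + f, e) gives c^2 (1 + d) =
      0.\<close>
    then show ?thesis
      using ef1 ef2 eg by (auto simp: e_def f_def g_def)
  qed
qed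

lemma isomorphic_S_iff_approx:
  fixes p q :: "'k::field"
  assumes nz: "p \<noteq> 0" "q \<noteq> 0"
  shows "algebra_isomorphic ((*s) :: 'k \<Rightarrow> 'k^2 \<Rightarrow> 'k^2) (S_mult p 0 0 0 0 0) (*s) (S_mult q 0 0 0 0 0)
    \<longleftrightarrow> (p, q) \<in> approx_rel" (is "?iso p q \<longleftrightarrow> _")
proof
  assume "?iso p q"
  then obtain \<phi> :: "'k^2 \<Rightarrow> 'k^2" where lin: "Vector_Spaces.linear (*s) (*s) \<phi>" and "inj \<phi>"
    and mult: "\<And>x y. \<phi> (S_mult p 0 0 0 0 0 x y) = S_mult q 0 0 0 0 0 (\<phi> x) (\<phi> y)"
    by (auto simp: algebra_isomorphic_def bij_def)
  interpret \<phi>: Vector_Spaces.linear "(*s)" "(*s)" \<phi>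
    by (rule lin)
  define e f :: "'k^2" where "e = vector [1, 0]" and "f = vector [0, 1]"
  have table: "S_mult p 0 0 0 0 0 e e = f" "S_mult p 0 0 0 0 0 e f = 0"
    "S_mult p 0 0 0 0 0 f f = p *s e"
    by (simp_all add: vec_eq_iff forall_2 e_def f_def)
  define u v where "u = \<phi> e $ 1" and "v = \<phi> e $ 2"
  \<comment> \<open>Injectivity enters here, to exclude u = v = 0.\<close>
  have "e \<noteq> 0"
    by (metis e_def vector_2(1) zero_index zero_neq_one)
  then have "\<phi> e \<noteq> 0"
    using \<open>inj \<phi>\<close> by (metis \<phi>.zero injD)
  then have uv_nz: "u \<noteq> 0 \<or> v \<noteq> 0"
    by (simp add: u_def v_def vec_eq_iff forall_2)
  have f: "\<phi> f $ 1 = v * v * q" "\<phi> f $ 2 = u * u"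
    using mult[of e e] by (simp_all add: table u_def v_def)
  have "v * (u * u) * q = 0"
    using arg_cong[OF mult[of e f], of "\<lambda>x. x $ 1"] f by (simp add: table u_def v_def)
  then have uv: "u = 0 \<or> v = 0"
    using nz by auto
  have ff: "p * u = u * u * (u * u) * q" "p * v = v * v * q * (v * v * q)"
    using arg_cong[OF mult[of f f], of "\<lambda>x. x $ 1"] arg_cong[OF mult[of f f], of "\<lambda>x. x $ 2"] f
    by (simp_all add: table u_def v_def \<phi>.scale)
  show "(p, q) \<in> approx_rel"
  proof (cases "u = 0")
    case True
    then have "v \<noteq> 0" using uv_nz by simp
    then have "p = v ^ 3 * q\<^sup>2"
      using ff(2) by (simp add: eval_nat_numeral)
    \<comment> \<open>The square falls on \<open>q\<close>, so the relation first appears as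
      \<open>(q, p)\<close> and symmetry of \<open>approx_rel\<close> turns it round.\<close>
    then have "q\<^sup>2 = (inverse v) ^ 3 * p"
      using \<open>v \<noteq> 0\<close> by (simp add: field_simps)
    then have "cube_sim (q\<^sup>2) p"
      using nz \<open>v \<noteq> 0\<close> by (intro cube_simI[of "inverse v"]) auto
    then have "(q, p) \<in> approx_rel"
      using nz by (simp add: approx_rel_def)
    then show ?thesis
      using equiv_approx_rel by (meson equivE symE)
  next
    case False
    then have "p = u ^ 3 * q"
      using ff(1) by (simp add: eval_nat_numeral)
    then show ?thesis
      using nz False by (auto simp: approx_rel_def intro: cube_simI)
  qed
next
  assume "(p, q) \<in> approx_rel"
  then consider k where "k \<noteq> 0" "p = k ^ 3 * q" | k where "k \<noteq> 0" "p\<^sup>2 = k ^ 3 * q"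
    using nz by (auto simp: approx_rel_def elim: cube_simE)
  then show "?iso p q"
  proof cases
    case (1 k)
    \<comment> \<open>The case u = k, v = 0: e goes to k e, which forces f = e^2 to go to k^2
      f.\<close>
    define \<phi> :: "'k^2 \<Rightarrow> 'k^2" where "\<phi> x = vector [k * x $ 1, k\<^sup>2 * x $ 2]" for x
    define \<psi> :: "'k^2 \<Rightarrow> 'k^2" where "\<psi> x = vector [x $ 1 / k, x $ 2 / k\<^sup>2]" for x
    have "Vector_Spaces.linear (*s) (*s) \<phi>"
      by unfold_locales
        (simp_all add: \<phi>_def vec_eq_iff forall_2 algebra_simps add_divide_distrib)
    moreover have "\<psi> (\<phi> x) = x" "\<phi> (\<psi> x) = x" for x
      using 1 by (simp_all add: \<phi>_def \<psi>_def vec_eq_iff forall_2)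
    then have "bij \<phi>"
      by (intro o_bij[of \<psi>]) auto
    moreover have "\<phi> (S_mult p 0 0 0 0 0 x y) = S_mult q 0 0 0 0 0 (\<phi> x) (\<phi> y)" for x y
      using 1 by (simp add: \<phi>_def vec_eq_iff forall_2 eval_nat_numeral)
    ultimately show ?thesis
      unfolding algebra_isomorphic_def by blast
  next
    case (2 k)
    \<comment> \<open>The case u = 0: v = k^2 / p solves p = q^2 v^3, and f = e^2 must go to q v^2 e
      = k e.\<close>
    define \<phi> :: "'k^2 \<Rightarrow> 'k^2" where "\<phi> x = vector [k * x $ 2, k\<^sup>2 / p * x $ 1]" for x
    define \<psi> :: "'k^2 \<Rightarrow> 'k^2" where "\<psi> x = vector [p / k\<^sup>2 * x $ 2, x $ 1 / k]" for x
    have q: "q = p\<^sup>2 / k ^ 3"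
      using 2 by simp
    have "Vector_Spaces.linear (*s) (*s) \<phi>"
      by unfold_locales
        (simp_all add: \<phi>_def vec_eq_iff forall_2 algebra_simps add_divide_distrib)
    moreover have "\<psi> (\<phi> x) = x" "\<phi> (\<psi> x) = x" for x
      using 2 nz by (simp_all add: \<phi>_def \<psi>_def vec_eq_iff forall_2)
    then have "bij \<phi>"
      by (intro o_bij[of \<psi>]) auto
    moreover have "\<phi> (S_mult p 0 0 0 0 0 x y) = S_mult q 0 0 0 0 0 (\<phi> x) (\<phi> y)" for x y
      using 2(1) nz by (simp add: \<phi>_def q vec_eq_iff forall_2 eval_nat_numeral)
    ultimately show ?thesis
      unfolding algebra_isomorphic_def by blast
  qed
qed

theorem theorem1:
  fixes H :: "'k::field set"
    and smul :: "'k \<Rightarrow> 'v::ab_group_add \<Rightarrow> 'v"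
    and mul :: "'v \<Rightarrow> 'v \<Rightarrow> 'v"
  assumes "complete_representatives H"
  shows "(\<forall>p \<in> H.
            straight ((*s) :: 'k \<Rightarrow> 'k^2 \<Rightarrow> 'k^2) (S_mult p 0 0 0 0 0) \<and>
            endo_commutative_type_I ((*s) :: 'k \<Rightarrow> 'k^2 \<Rightarrow> 'k^2) (S_mult p 0 0 0 0 0)) \<and>
         (endo_commutative_type_I smul mul \<longrightarrow>
            (\<exists>!p. p \<in> H \<and>
               algebra_isomorphic smul mul ((*s) :: 'k \<Rightarrow> 'k^2 \<Rightarrow> 'k^2) (S_mult p 0 0 0 0 0)))"
proof (intro conjI ballI impI)
  fix p assume "p \<in> H"
  then have "p \<noteq> 0"
    using assms by (auto simp: complete_representatives_def)
  show "straight ((*s) :: 'k \<Rightarrow> 'k^2 \<Rightarrow> 'k^2) (S_mult p 0 0 0 0 0)"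
    by (rule has_form_S_imp_straight[OF has_form_S_S_mult])
  show "endo_commutative_type_I ((*s) :: 'k \<Rightarrow> 'k^2 \<Rightarrow> 'k^2) (S_mult p 0 0 0 0 0)"
    unfolding endo_commutative_type_I_def
    using endo_commutative_S_p_zero has_form_S_S_mult \<open>p \<noteq> 0\<close> by blast
next
  let ?iso = "\<lambda>p. algebra_isomorphic smul mul ((*s) :: 'k \<Rightarrow> 'k^2 \<Rightarrow> 'k^2) (S_mult p 0 0 0 0 0)"
  assume "endo_commutative_type_I smul mul"
  then obtain p q a b c d where ec: "endo_commutative smul mul"
    and form: "has_form_S smul mul p q a b c d"
    and type_I: "p \<noteq> 0 \<and> a = 0 \<and> c = 0 \<or> p = 0 \<and> a \<noteq> 0 \<and> c = 0 \<or> p = 0 \<and> a = 0 \<and> c \<noteq> 0"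
    unfolding endo_commutative_type_I_def by blast
  note iso = has_form_S_imp_isomorphic[OF form]
  have "p \<noteq> 0 \<and> q = 0 \<and> a = 0 \<and> b = 0 \<and> c = 0 \<and> d = 0"
    using endo_commutative_isomorphic[OF iso ec nonassoc_algebra_S] type_I
    by (rule endo_commutative_S_type_I)
  with iso have "p \<noteq> 0" and iso_p: "?iso p"
    by simp_all
  \<comment> \<open>Since the given algebra is isomorphic to the model for \<open>p\<close>, the
    nonzero parameters it admits form exactly the class of \<open>p\<close>.\<close>
  have iso_iff: "?iso h \<longleftrightarrow> h \<in> approx_rel `` {p}" if "h \<noteq> 0" for h
    using isomorphic_S_iff_approx[OF \<open>p \<noteq> 0\<close> that] iso_p
    by (auto intro: algebra_isomorphic_trans algebra_isomorphic_sym)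
  have "approx_rel `` {p} \<in> (- {0}) // approx_rel"
    using \<open>p \<noteq> 0\<close> by (intro quotientI) simp
  \<comment> \<open>\<open>H\<close> avoids 0, so \<open>iso_iff\<close> applies to all its members,
    and it meets the class of \<open>p\<close> exactly once.\<close>
  then have "H \<subseteq> - {0}" "\<exists>!h. h \<in> H \<and> h \<in> approx_rel `` {p}"
    using assms unfolding complete_representatives_def by blast+
  with iso_iff show "\<exists>!h. h \<in> H \<and> ?iso h"
    by (metis ComplD insertI1 subsetD)
qed

end
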